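(* Let $3\le k<n$ be integers. Let $\mathscr{B}$ be a family (set) of boxes in $\{0,1\}^n$ satisfying the following conditions: ($\alpha$) $|\operatorname{prop}(B)|=k$ for every $B\in\mathscr{B}$; ($\beta$) $\operatorname{prop}(A)\neq\operatorname{prop}(B)$ whenever $A,B\in\mathscr{B}$ and $A\neq B$; ($\gamma$) the boxes belonging to $\mathscr{B}$ are pairwise disjoint. Then $|\mathscr{B}|\le 2^k-2$.
   Context: A box in $\{0,1\}^n$ is a set of the form $B=B_1\times\cdots\times B_n$, where each $B_i$ is a nonempty subset of $\{0,1\}$, i.e. $B_i\in\{\{0\},\{1\},\{0,1\}\}$. For such a box, $\operatorname{prop}(B)=\{i\in[n]\colon B_i\neq\{0,1\}\}$, where $[n]=\{1,2,\ldots,n\}$. Two boxes $A,B$ are disjoint if $A\cap B=\emptyset$ as subsets of $\{0,1\}^n$; equivalently, there is $i$ such that $A_i=\{0\}$ and $B_i=\{1\}$, or vice versa. *)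

theory Defs
  imports Main "HOL-Library.FuncSet"
begin

text \<open>
  Points of \<open>{0,1}\<^sup>n\<close> are extensional functions on \<open>{1..n}\<close>, so the points of the cube, and
  hence the boxes, are determined by their coordinates \<open>1, \<dots>, n\<close> alone. A box is the set of
  points itself.
\<close>

definition is_box :: "nat \<Rightarrow> (nat \<Rightarrow> nat) set \<Rightarrow> bool" where
  "is_box n B \<longleftrightarrow>
     (\<exists>C. (\<forall>i\<in>{1..n}. C i \<noteq> {} \<and> C i \<subseteq> {0, 1}) \<and> B = (\<Pi>\<^sub>E i\<in>{1..n}. C i))"

text \<open>
  The factor \<open>B\<^sub>i\<close> of a box is recovered as the projection of \<open>B\<close> to coordinate \<open>i\<close>; see
  \<open>box_factor_PiE\<close> below. Nonemptiness of all the factors matters here.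
\<close>

definition box_factor :: "(nat \<Rightarrow> nat) set \<Rightarrow> nat \<Rightarrow> nat set" where
  "box_factor B i = (\<lambda>x. x i) ` B"

definition box_prop :: "nat \<Rightarrow> (nat \<Rightarrow> nat) set \<Rightarrow> nat set" where
  "box_prop n B = {i \<in> {1..n}. box_factor B i \<noteq> {0, 1}}"

lemma box_factor_PiE:
  assumes "\<And>j. j \<in> {1..n} \<Longrightarrow> C j \<noteq> {}" and "i \<in> {1..n}"
  shows "box_factor (\<Pi>\<^sub>E j\<in>{1..n}. C j) i = C i"
proof -
  have "(\<Pi>\<^sub>E j\<in>{1..n}. C j) \<noteq> {}"
    using assms(1) by (simp add: PiE_eq_empty_iff)
  then show ?thesis
    using assms(2) by (simp add: box_factor_def image_projection_PiE)
qed

lemma box_prop_PiE: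
  assumes "\<And>j. j \<in> {1..n} \<Longrightarrow> C j \<noteq> {}"
  shows "box_prop n (\<Pi>\<^sub>E j\<in>{1..n}. C j) = {i \<in> {1..n}. C i \<noteq> {0, 1}}"
  unfolding box_prop_def by (intro Collect_cong conj_cong refl) (simp only: box_factor_PiE[OF assms])

lemma finite_boxes: "finite {B. is_box n B}"
proof (rule finite_subset)
  show "{B. is_box n B} \<subseteq> Pow (\<Pi>\<^sub>E i\<in>{1..n}. {0, 1})"
  proof (intro subsetI PowI)
    fix B x
    assume "B \<in> {B. is_box n B}" and "x \<in> B"
    then obtain C where "\<forall>i\<in>{1..n}. C i \<noteq> {} \<and> C i \<subseteq> {0, 1}" "x \<in> (\<Pi>\<^sub>E i\<in>{1..n}. C i)"
      unfolding is_box_def by blast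
    then have "\<And>i. i \<in> {1..n} \<Longrightarrow> x i \<in> {0, 1}" and "x \<in> extensional {1..n}"
      by (meson PiE_mem subsetD, simp only: PiE_iff)
    then show "x \<in> (\<Pi>\<^sub>E i\<in>{1..n}. {0, 1})"
      by (simp only: PiE_iff) blast
  qed
  show "finite (Pow (\<Pi>\<^sub>E i\<in>{1..n}. {0, 1 :: nat}))"
    by (simp add: finite_PiE)
qed

end

theory Submission
  imports Defs
begin

text \<open>
  The proof is Fourier analysis on \<open>{0,1}\<^sup>n\<close>, with the characters
  \<open>\<chi>\<^sub>S(x) = (-1)\<^bsup>\<Sum>i\<in>S. x\<^sub>i\<^esup>\<close>. Over a box, \<open>\<chi>\<^sub>S\<close> sums to zero unless
  \<open>S \<subseteq> prop B\<close>, and is constant otherwise (\<open>abs_sum_character_box\<close>).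

  Let \<open>F\<close> be the set of points covered by no box, and let \<open>S = prop B\<close> for a box \<open>B\<close> of the
  family. The full cube contributes \<open>0\<close> to \<open>\<Sum>x\<in>F. \<chi>\<^sub>S(x)\<close>, and so does every other box \<open>A\<close>,
  because \<open>prop A\<close> is a different set of the same size and so cannot contain \<open>S\<close>. Only \<open>B\<close>
  remains, so the sum is \<open>\<plusminus>2\<^bsup>n-k\<^esup>\<close> (\<open>abs_sum_character_uncovered\<close>). Therefore
  \<open>|F| \<ge> 2\<^bsup>n-k\<^esup>\<close>, and since each box has \<open>2\<^bsup>n-k\<^esup>\<close> points, the family has at most
  \<open>2\<^sup>k - 1\<close> boxes.

  Suppose that it has exactly \<open>2\<^sup>k - 1\<close>. Then \<open>|F| = 2\<^bsup>n-k\<^esup>\<close>, and the sum just computed is as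
  large as it can be: every \<open>\<chi>\<^bsub>prop B\<^esub>\<close> is constant on \<open>F\<close>. The sets \<open>T\<close> for which
  \<open>\<chi>\<^sub>T\<close> is constant on \<open>F\<close> form a binary linear code \<open>H\<close>, that is, a family closed under symmetric
  difference. Orthogonality of the characters gives \<open>|F| |H| \<le> 2\<^sup>n\<close>
  (\<open>card_constant_characters\<close>), so \<open>|H| \<le> 2\<^sup>k\<close>. But \<open>H\<close> already contains the empty set and the
  \<open>2\<^sup>k - 1\<close> sets \<open>prop B\<close>, hence nothing else: \<open>H\<close> is a linear code of dimension \<open>k\<close> all of whose
  nonzero words have weight \<open>k\<close>. Counting incidences shows that in a code of dimension \<open>k\<close> and
  constant weight \<open>w\<close> the number \<open>2\<^bsup>k-1\<^esup>\<close> divides \<open>w\<close> (\<open>constant_weight_code_dvd\<close>). So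
  \<open>2\<^bsup>k-1\<^esup> \<le> k\<close>, which fails for \<open>k \<ge> 3\<close>. (For \<open>k = 2\<close> there
  is no contradiction: the boxes \<open>01*\<close>, \<open>*01\<close>, \<open>1*0\<close> leave \<open>F = {000, 111}\<close> uncovered, and the
  code is \<open>{\<emptyset>, {1,2}, {2,3}, {1,3}}\<close>.)
\<close>

section \<open>Characters of the cube\<close>

definition cube :: "nat \<Rightarrow> (nat \<Rightarrow> nat) set" where
  "cube n = (\<Pi>\<^sub>E i\<in>{1..n}. {0, 1})"

definition character :: "nat set \<Rightarrow> (nat \<Rightarrow> nat) \<Rightarrow> int" where
  "character S x = (\<Prod>i\<in>S. (-1) ^ x i)"

lemma character_empty [simp]: "character {} x = 1"
  by (simp add: character_def)

lemma abs_prod_int: "\<bar>\<Prod>i\<in>A. f i :: int\<bar> = (\<Prod>i\<in>A. \<bar>f i\<bar>)"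
  by (induction A rule: infinite_finite_induct) (simp_all add: abs_mult)

lemma abs_character [simp]: "\<bar>character S x\<bar> = 1"
  unfolding character_def abs_prod_int by (rule prod.neutral) (simp add: power_abs)

lemma character_square [simp]: "character S x * character S x = 1"
  using abs_character[of S x] by (metis abs_mult_self_eq mult_1)

lemma character_mult:
  assumes "finite S" "finite T"
  shows "character S x * character T x = character (sym_diff S T) x"
proof -
  have split: "character A x = character (A - B) x * character (A \<inter> B) x" if "finite A" for A B
    unfolding character_def
    using prod.subset_diff[of "A \<inter> B" A "\<lambda>i. (-1) ^ x i :: int"] that
    by (simp add: Diff_Int_distrib Diff_Int)
  have "character S x * character T x
      = character (S - T) x * character (T - S) x * (character (S \<inter> T) x * character (S \<inter> T) x)"
    using split[OF assms(1), of T] split[OF assms(2), of S] by (simp add: Int_commute mult_ac)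
  also have "\<dots> = character (S - T) x * character (T - S) x"
    by simp
  also have "\<dots> = character (sym_diff S T) x"
    unfolding character_def using assms by (subst prod.union_disjoint) auto
  finally show ?thesis .
qed

lemma box_prop_subset: "box_prop n B \<subseteq> {1..n}"
  unfolding box_prop_def by blast

lemma finite_box_prop: "finite (box_prop n B)"
  using box_prop_subset finite_atLeastAtMost by (rule finite_subset)

text \<open>
  The sum factorises over the coordinates. A coordinate in \<open>box_prop n B\<close> takes one value and
  contributes a sign; a free coordinate contributes \<open>1 - 1 = 0\<close> if it lies in \<open>S\<close> and
  \<open>1 + 1 = 2\<close> if it does not. The cases \<open>S = {}\<close> and \<open>B = cube n\<close> give the size of a box and
  the vanishing of nontrivial characters over the cube.
\<close>

lemma abs_sum_character_box:
  assumes "is_box n B" "S \<subseteq> {1..n}"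
  shows "\<bar>\<Sum>x\<in>B. character S x\<bar> = (if S \<subseteq> box_prop n B then 2 ^ (n - card (box_prop n B)) else 0)"
proof -
  obtain C where C: "\<And>i. i \<in> {1..n} \<Longrightarrow> C i \<noteq> {} \<and> C i \<subseteq> {0, 1}" and B: "B = (\<Pi>\<^sub>E i\<in>{1..n}. C i)"
    using assms(1) unfolding is_box_def by blast
  have free: "box_prop n B = {i \<in> {1..n}. C i \<noteq> {0, 1}}"
    unfolding B using C by (intro box_prop_PiE) auto
  let ?f = "\<lambda>i b. if i \<in> S then (-1) ^ b else (1 :: int)"
  have char: "character S x = (\<Prod>i\<in>{1..n}. ?f i (x i))" for x
    unfolding character_def using assms(2) by (simp add: prod.inter_restrict[symmetric] Int_absorb1)
  have fin: "finite (C i)" if "i \<in> {1..n}" for i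
    using C[OF that] finite_subset by blast
  have "(\<Sum>x\<in>B. character S x) = (\<Prod>i\<in>{1..n}. \<Sum>b\<in>C i. ?f i b)"
    unfolding B char using fin by (intro prod_sum_PiE[symmetric]) auto
  also have "\<bar>\<dots>\<bar> = (\<Prod>i\<in>{1..n}. if i \<in> box_prop n B then 1 else if i \<in> S then 0 else 2)"
    unfolding abs_prod_int
  proof (rule prod.cong[OF refl])
    fix i assume i: "i \<in> {1..n}"
    then have "C i = {0} \<or> C i = {1} \<or> C i = {0, 1}"
      using C[OF i] by blast
    then show "\<bar>\<Sum>b\<in>C i. ?f i b\<bar> = (if i \<in> box_prop n B then 1 else if i \<in> S then 0 else 2)"
    proof (elim disjE)
      assume "C i = {0}"
      then have "i \<in> box_prop n B"
        using i unfolding free by (metis (mono_tags, lifting) CollectI insertI1 insertI2 singletonD zero_neq_one)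
      then show ?thesis unfolding \<open>C i = {0}\<close> by simp
    next
      assume "C i = {1}"
      then have "i \<in> box_prop n B"
        using i unfolding free by (metis (mono_tags, lifting) CollectI insertI1 singletonD zero_neq_one)
      then show ?thesis unfolding \<open>C i = {1}\<close> by simp
    next
      assume "C i = {0, 1}"
      then have "i \<notin> box_prop n B"
        unfolding free by simp
      then show ?thesis unfolding \<open>C i = {0, 1}\<close> by simp
    qed
  qed
  also have "\<dots> = (if S \<subseteq> box_prop n B then 2 ^ (n - card (box_prop n B)) else 0)"
  proof (cases "S \<subseteq> box_prop n B")
    case True
    have "(\<Prod>i\<in>{1..n}. if i \<in> box_prop n B then 1 else if i \<in> S then 0 else 2)
        = (\<Prod>i\<in>{1..n}. if i \<in> {1..n} - box_prop n B then 2 else (1 :: int))"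
      using True by (intro prod.cong) auto
    also have "\<dots> = (\<Prod>i\<in>{1..n} - box_prop n B. 2)"
      by (simp only: prod.inter_restrict[symmetric] finite_atLeastAtMost Int_absorb1 Diff_subset)
    also have "\<dots> = 2 ^ (n - card (box_prop n B))"
      using card_Diff_subset[OF finite_box_prop box_prop_subset] by simp
    finally show ?thesis using True by simp
  next
    case False
    then obtain i where "i \<in> S" "i \<notin> box_prop n B" by blast
    then show ?thesis using False assms(2) by (intro trans[OF prod_zero]) auto
  qed
  finally show ?thesis .
qed

lemma is_box_cube: "is_box n (cube n)"
  unfolding is_box_def cube_def by (rule exI[of _ "\<lambda>_. {0, 1}"]) simp

lemma box_prop_cube: "box_prop n (cube n) = {}"
  unfolding cube_def by (simp add: box_prop_PiE del: One_nat_def)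

lemma finite_cube: "finite (cube n)"
  unfolding cube_def by (simp add: finite_PiE)

lemma box_subset_cube: "is_box n B \<Longrightarrow> B \<subseteq> cube n"
  unfolding is_box_def cube_def by (metis PiE_mono)

lemma finite_box: "is_box n B \<Longrightarrow> finite B"
  by (rule finite_subset[OF box_subset_cube finite_cube])

lemma card_box:
  assumes "is_box n B"
  shows "card B = 2 ^ (n - card (box_prop n B))"
proof -
  have "int (card B) = 2 ^ (n - card (box_prop n B))"
    using abs_sum_character_box[OF assms, of "{}"] by simp
  also have "\<dots> = int (2 ^ (n - card (box_prop n B)))"
    by simp
  finally show ?thesis
    by (simp only: of_nat_eq_iff)
qed

lemma card_cube: "card (cube n) = 2 ^ n"
  using card_box[OF is_box_cube, of n] by (simp add: box_prop_cube)

lemma sum_character_cube: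
  assumes "S \<subseteq> {1..n}" "S \<noteq> {}"
  shows "(\<Sum>x\<in>cube n. character S x) = 0"
  using abs_sum_character_box[OF is_box_cube assms(1)] assms(2) by (simp add: box_prop_cube)

lemma character_orthogonal:
  assumes "S \<subseteq> {1..n}" "T \<subseteq> {1..n}"
  shows "(\<Sum>x\<in>cube n. character S x * character T x) = (if S = T then 2 ^ n else 0)"
proof (cases "S = T")
  case True
  then show ?thesis by (simp add: card_cube)
next
  case False
  have fin: "finite S" "finite T"
    using assms finite_subset by blast+
  have "(\<Sum>x\<in>cube n. character (sym_diff S T) x) = 0"
    using assms False by (intro sum_character_cube) auto
  then show ?thesis
    using False by (simp add: character_mult[OF fin])
qed

section \<open>Characters that are constant on a set\<close>

text \<open>
  Up to signs, these are the parity checks satisfied by \<open>F\<close>; if \<open>F\<close> is an affine subspace, they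
  form the dual of its direction.
\<close>

definition constant_characters :: "nat \<Rightarrow> (nat \<Rightarrow> nat) set \<Rightarrow> nat set set" where
  "constant_characters n F =
     {S. S \<subseteq> {1..n} \<and> (\<forall>x\<in>F. \<forall>y\<in>F. character S x = character S y)}"

lemma finite_constant_characters: "finite (constant_characters n F)"
  by (rule finite_subset[of _ "Pow {1..n}"]) (auto simp: constant_characters_def)

lemma sym_diff_constant_characters:
  assumes "S \<in> constant_characters n F" "T \<in> constant_characters n F"
  shows "sym_diff S T \<in> constant_characters n F"
proof -
  have sub: "S \<subseteq> {1..n}" "T \<subseteq> {1..n}"
    using assms unfolding constant_characters_def by auto
  then have fin: "finite S" "finite T"
    using finite_subset by blast+
  have "character (sym_diff S T) x = character (sym_diff S T) y" if "x \<in> F" "y \<in> F" for x y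
    using assms that unfolding constant_characters_def character_mult[OF fin, symmetric]
    by (metis (mono_tags, lifting) mem_Collect_eq)
  then show ?thesis
    using sub unfolding constant_characters_def by blast
qed

text \<open>
  Bessel's inequality for the indicator function of \<open>F\<close>. Let \<open>g\<close> be the sum of the constant
  characters, each with the sign that makes it \<open>1\<close> on \<open>F\<close>. If there are \<open>m\<close> of them, then
  \<open>g = m\<close> on \<open>F\<close>, so \<open>g\<^sup>2\<close> sums to at least \<open>|F| m\<^sup>2\<close> over the cube, while by orthogonality it
  sums to exactly \<open>2\<^sup>n m\<close>.
\<close>

lemma card_constant_characters:
  assumes "F \<subseteq> cube n" "F \<noteq> {}"
  shows "card F * card (constant_characters n F) \<le> 2 ^ n"
proof -
  let ?G = "constant_characters n F"
  obtain x0 where x0: "x0 \<in> F" using assms(2) by blast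
  \<comment> \<open>The value at a fixed point of \<open>F\<close> is the sign that normalises a constant character.\<close>
  define g where "g x = (\<Sum>T\<in>?G. character T x0 * character T x)" for x
  have fin: "finite ?G" by (rule finite_constant_characters)
  have sub: "T \<subseteq> {1..n}" if "T \<in> ?G" for T
    using that by (simp add: constant_characters_def)
  have g_on_F: "g x = int (card ?G)" if "x \<in> F" for x
  proof -
    have "character T x0 * character T x = 1" if "T \<in> ?G" for T
    proof -
      have "character T x = character T x0"
        using that x0 \<open>x \<in> F\<close> unfolding constant_characters_def by blast
      then show ?thesis by simp
    qed
    then show ?thesis by (simp add: g_def)
  qed
  have "int (card F) * (int (card ?G))\<^sup>2 = (\<Sum>x\<in>F. (g x)\<^sup>2)"
    by (simp add: g_on_F)
  also have "\<dots> \<le> (\<Sum>x\<in>cube n. (g x)\<^sup>2)"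
    using assms(1) by (intro sum_mono2) (auto simp: finite_cube)
  also have "\<dots> = (\<Sum>x\<in>cube n. \<Sum>T\<in>?G. \<Sum>U\<in>?G.
      (character T x0 * character U x0) * (character T x * character U x))"
    unfolding g_def power2_eq_square sum_product by (simp only: mult_ac)
  also have "\<dots> = (\<Sum>T\<in>?G. \<Sum>U\<in>?G. (character T x0 * character U x0)
      * (\<Sum>x\<in>cube n. character T x * character U x))"
    unfolding sum_distrib_left by (subst sum.swap) (intro sum.cong refl sum.swap)
  also have "\<dots> = (\<Sum>T\<in>?G. \<Sum>U\<in>?G. (character T x0 * character U x0) * (if T = U then 2 ^ n else 0))"
    by (intro sum.cong refl) (simp only: character_orthogonal sub)
  also have "\<dots> = (\<Sum>T\<in>?G. 2 ^ n)"
  proof (rule sum.cong[OF refl])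
    fix T assume "T \<in> ?G"
    have "(\<Sum>U\<in>?G. (character T x0 * character U x0) * (if T = U then 2 ^ n else 0))
        = (\<Sum>U\<in>?G. if T = U then 2 ^ n else 0)"
      by (intro sum.cong refl) auto
    then show "(\<Sum>U\<in>?G. (character T x0 * character U x0) * (if T = U then 2 ^ n else 0)) = 2 ^ n"
      using fin \<open>T \<in> ?G\<close> by (simp add: sum.delta)
  qed
  also have "\<dots> = int (card ?G) * 2 ^ n"
    by simp
  finally have "int (card ?G) * (int (card F) * int (card ?G)) \<le> int (card ?G) * 2 ^ n"
    by (simp add: power2_eq_square mult_ac)
  moreover have "card ?G > 0"
    using fin by (auto simp: card_gt_0_iff constant_characters_def intro!: exI[of _ "{}"])
  ultimately have "int (card F) * int (card ?G) \<le> 2 ^ n"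
    by simp
  then have "int (card F * card ?G) \<le> int (2 ^ n)"
    by simp
  then show ?thesis
    by (simp only: of_nat_le_iff)
qed

text \<open>
  The equality case of the triangle inequality: two opposite signs would cancel and leave only
  \<open>card F - 2\<close> terms.
\<close>

lemma constant_if_abs_sum_eq_card:
  fixes f :: "'a \<Rightarrow> int"
  assumes "finite F" and abs: "\<And>x. x \<in> F \<Longrightarrow> \<bar>f x\<bar> = 1"
    and sum: "\<bar>\<Sum>x\<in>F. f x\<bar> = int (card F)" and "x \<in> F" "y \<in> F"
  shows "f x = f y"
proof (rule ccontr)
  assume neq: "f x \<noteq> f y"
  then have "x \<noteq> y" by auto
  have pair: "{x, y} \<subseteq> F"
    using \<open>x \<in> F\<close> \<open>y \<in> F\<close> by simp
  have "card {x, y} = 2" "card {x, y} \<le> card F"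
    using \<open>x \<noteq> y\<close> card_mono[OF \<open>finite F\<close> pair] by simp_all
  then have card: "card F = Suc (Suc (card (F - {x, y})))"
    using card_Diff_subset[OF _ pair] by simp
  have "f x + f y = 0"
    using neq abs[OF \<open>x \<in> F\<close>] abs[OF \<open>y \<in> F\<close>] by linarith
  then have "\<bar>\<Sum>x\<in>F. f x\<bar> = \<bar>\<Sum>x\<in>F - {x, y}. f x\<bar>"
    using sum.subset_diff[OF pair \<open>finite F\<close>, of f] \<open>x \<noteq> y\<close> by simp
  also have "\<dots> \<le> (\<Sum>x\<in>F - {x, y}. \<bar>f x\<bar>)"
    by (rule sum_abs)
  also have "\<dots> = int (card (F - {x, y}))"
    using abs by simp
  finally show False
    using sum card by linarith
qed

section \<open>Constant-weight linear codes\<close>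

text \<open>
  Adding a word that contains \<open>i\<close> exchanges the words that contain \<open>i\<close> with those that do not.
\<close>

lemma card_code_members_containing:
  assumes "finite G" and closed: "\<And>S T. S \<in> G \<Longrightarrow> T \<in> G \<Longrightarrow> sym_diff S T \<in> G"
    and "i \<in> \<Union>G"
  shows "2 * card {T \<in> G. i \<in> T} = card G"
proof -
  obtain S where S: "S \<in> G" "i \<in> S" using assms(3) by blast
  have "bij_betw (sym_diff S) {T \<in> G. i \<in> T} {T \<in> G. i \<notin> T}"
  proof (rule bij_betw_byWitness[where f' = "sym_diff S"])
    show "sym_diff S ` {T \<in> G. i \<in> T} \<subseteq> {T \<in> G. i \<notin> T}"
      using S closed by auto
    show "sym_diff S ` {T \<in> G. i \<notin> T} \<subseteq> {T \<in> G. i \<in> T}"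
      using S closed by auto
  qed blast+
  then have "card {T \<in> G. i \<in> T} = card {T \<in> G. i \<notin> T}"
    by (rule bij_betw_same_card)
  moreover have "card G = card {T \<in> G. i \<in> T} + card {T \<in> G. i \<notin> T}"
    using \<open>finite G\<close> by (subst card_Un_disjoint[symmetric]) (auto intro: arg_cong[of _ _ card])
  ultimately show ?thesis by simp
qed

text \<open>
  Count the pairs \<open>i \<in> T \<in> G\<close> in two ways. By words, there are \<open>(2\<^bsup>d+1\<^esup> - 1) w\<close>; by
  coordinates, every one that occurs at all lies in \<open>2\<^sup>d\<close> words. As \<open>2\<^bsup>d+1\<^esup> - 1\<close> is odd,
  \<open>2\<^sup>d\<close> must divide \<open>w\<close>.
\<close>

lemma constant_weight_code_dvd:
  assumes "finite G" and fin: "\<And>T. T \<in> G \<Longrightarrow> finite T"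
    and closed: "\<And>S T. S \<in> G \<Longrightarrow> T \<in> G \<Longrightarrow> sym_diff S T \<in> G"
    and card: "card G = 2 ^ Suc d"
    and weight: "\<And>T. T \<in> G \<Longrightarrow> T \<noteq> {} \<Longrightarrow> card T = w"
  shows "2 ^ d dvd w"
proof -
  have "G \<noteq> {}" using card by auto
  then have empty: "{} \<in> G" using closed by fastforce
  have half: "card {T \<in> G. i \<in> T} = 2 ^ d" if "i \<in> \<Union>G" for i
    using card_code_members_containing[OF \<open>finite G\<close> closed that] card by simp
  have "(2 * 2 ^ d - 1) * w = (\<Sum>T\<in>G - {{}}. w)"
    using empty card \<open>finite G\<close> by simp
  also have "\<dots> = (\<Sum>T\<in>G - {{}}. card T)"
    using weight by simp
  also have "\<dots> = (\<Sum>T\<in>G. card T)"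
    using \<open>finite G\<close> by (intro sum.mono_neutral_left) auto
  also have "\<dots> = (\<Sum>T\<in>G. card {i \<in> \<Union>G. i \<in> T})"
    by (intro sum.cong refl arg_cong[of _ _ card]) auto
  also have "\<dots> = 2 ^ d * card (\<Union>G)"
    using \<open>finite G\<close> fin half by (intro sum_multicount) auto
  finally have "2 ^ d dvd (2 * 2 ^ d - 1) * w"
    by simp
  moreover have "coprime (2 ^ d) (2 * 2 ^ d - 1 :: nat)"
    by simp
  ultimately show ?thesis
    using coprime_dvd_mult_right_iff by blast
qed

section \<open>Families of disjoint boxes\<close>

text \<open>
  Among the cube and the boxes removed from it, only \<open>B\<close> has a nonzero coefficient at
  \<open>box_prop n B\<close>: the other boxes have a different set of the same size, which cannot contain
  \<open>box_prop n B\<close>.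
\<close>

lemma abs_sum_character_uncovered:
  assumes boxes: "\<And>B. B \<in> \<B> \<Longrightarrow> is_box n B"
    and alpha: "\<And>B. B \<in> \<B> \<Longrightarrow> card (box_prop n B) = k"
    and beta: "\<And>A B. A \<in> \<B> \<Longrightarrow> B \<in> \<B> \<Longrightarrow> A \<noteq> B \<Longrightarrow> box_prop n A \<noteq> box_prop n B"
    and gamma: "pairwise disjnt \<B>"
    and "B \<in> \<B>" "k > 0"
  shows "\<bar>\<Sum>x\<in>cube n - \<Union>\<B>. character (box_prop n B) x\<bar> = 2 ^ (n - k)"
proof -
  let ?S = "box_prop n B"
  have sub: "?S \<subseteq> {1..n}" by (rule box_prop_subset)
  have S: "?S \<noteq> {}" using alpha[OF \<open>B \<in> \<B>\<close>] \<open>k > 0\<close> by auto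
  have finB: "finite A" if "A \<in> \<B>" for A
    using finite_box[OF boxes[OF that]] .
  have fin: "finite \<B>"
    by (rule finite_subset[OF _ finite_boxes[of n]]) (use boxes in blast)
  have other: "(\<Sum>x\<in>A. character ?S x) = 0" if A: "A \<in> \<B>" "A \<noteq> B" for A
  proof -
    have "\<not> ?S \<subseteq> box_prop n A"
      using card_subset_eq[OF finite_box_prop, of ?S n A] alpha A beta \<open>B \<in> \<B>\<close> by metis
    then show ?thesis
      using abs_sum_character_box[OF boxes[OF A(1)] sub] by simp
  qed
  have "(\<Sum>x\<in>cube n - \<Union>\<B>. character ?S x)
      = (\<Sum>x\<in>cube n. character ?S x) - (\<Sum>x\<in>\<Union>\<B>. character ?S x)"
    using box_subset_cube boxes by (intro sum_diff finite_cube) blast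
  also have "(\<Sum>x\<in>cube n. character ?S x) = 0"
    by (rule sum_character_cube[OF sub S])
  also have "(\<Sum>x\<in>\<Union>\<B>. character ?S x) = (\<Sum>A\<in>\<B>. \<Sum>x\<in>A. character ?S x)"
    using gamma finB by (subst sum.Union_disjoint) (auto simp: pairwise_def disjnt_def)
  also have "\<dots> = (\<Sum>x\<in>B. character ?S x)"
    using fin \<open>B \<in> \<B>\<close> other by (simp add: sum.remove)
  finally show ?thesis
    using abs_sum_character_box[OF boxes[OF \<open>B \<in> \<B>\<close>] sub] alpha[OF \<open>B \<in> \<B>\<close>] by simp
qed

theorem theorem1:
  fixes k n :: nat and \<B> :: "(nat \<Rightarrow> nat) set set"
  assumes "3 \<le> k" and "k < n"
    and boxes: "\<And>B. B \<in> \<B> \<Longrightarrow> is_box n B"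
    and alpha: "\<And>B. B \<in> \<B> \<Longrightarrow> card (box_prop n B) = k"
    and beta: "\<And>A B. A \<in> \<B> \<Longrightarrow> B \<in> \<B> \<Longrightarrow> A \<noteq> B \<Longrightarrow> box_prop n A \<noteq> box_prop n B"
    and gamma: "pairwise disjnt \<B>"
  shows "card \<B> \<le> 2 ^ k - 2"
proof (rule ccontr)
  assume "\<not> card \<B> \<le> 2 ^ k - 2"
  then have many: "card \<B> \<ge> 2 ^ k - 1" by linarith
  let ?F = "cube n - \<Union>\<B>"
  let ?P = "box_prop n ` \<B>"
  let ?H = "constant_characters n ?F"
  have "(2 :: nat) ^ 3 \<le> 2 ^ k"
    using \<open>3 \<le> k\<close> by (rule power_increasing) simp
  then have "\<B> \<noteq> {}" using many by auto
  then obtain B0 where B0: "B0 \<in> \<B>" by blast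
  have two_n: "(2 :: nat) ^ n = 2 ^ k * 2 ^ (n - k)"
    using \<open>k < n\<close> by (simp add: power_add[symmetric])
  have finite: "finite \<B>"
    by (rule finite_subset[OF _ finite_boxes[of n]]) (use boxes in blast)
  have finF: "finite ?F" by (simp add: finite_cube)
  have sum_F: "\<bar>\<Sum>x\<in>?F. character (box_prop n B) x\<bar> = 2 ^ (n - k)" if "B \<in> \<B>" for B
    using abs_sum_character_uncovered[OF boxes alpha beta gamma that] \<open>3 \<le> k\<close> by simp
  have "card (\<Union>\<B>) = (\<Sum>B\<in>\<B>. card B)"
    using gamma finite_box[OF boxes] by (intro card_Union_disjoint) auto
  also have "\<dots> = card \<B> * 2 ^ (n - k)"
    using card_box[OF boxes] alpha by simp
  finally have covered: "card (\<Union>\<B>) = card \<B> * 2 ^ (n - k)" .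
  have "\<Union>\<B> \<subseteq> cube n"
    using boxes box_subset_cube by blast
  then have "card ?F = 2 ^ n - card \<B> * 2 ^ (n - k)"
    using covered by (simp add: card_Diff_subset finite_cube finite_subset card_cube)
  also have "\<dots> = (2 ^ k - card \<B>) * 2 ^ (n - k)"
    by (simp add: two_n diff_mult_distrib)
  finally have card_F: "card ?F = (2 ^ k - card \<B>) * 2 ^ (n - k)" .
  \<comment> \<open>A character sum over \<open>F\<close> is at most \<open>|F|\<close>; this excludes a partition of the cube.\<close>
  have "(2 :: int) ^ (n - k) \<le> (\<Sum>x\<in>?F. \<bar>character (box_prop n B0) x\<bar>)"
    unfolding sum_F[OF B0, symmetric] by (rule sum_abs)
  then have "int (2 ^ (n - k)) \<le> int (card ?F)" by simp
  then have F_large: "2 ^ (n - k) \<le> card ?F" by (simp only: of_nat_le_iff)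
  then have "card ?F \<noteq> 0"
    by (metis le_zero_eq power_not_zero zero_neq_numeral)
  then have "2 ^ k - card \<B> \<noteq> 0" unfolding card_F by simp
  then have card_B: "card \<B> = 2 ^ k - 1" and one: "2 ^ k - card \<B> = 1"
    using many by linarith+
  have card_F': "card ?F = 2 ^ (n - k)"
    unfolding card_F one by simp
  have "?F \<noteq> {}" using \<open>card ?F \<noteq> 0\<close> by (metis card.empty)
  have "{} \<notin> ?P" using alpha \<open>3 \<le> k\<close> by fastforce
  moreover have "card ?P = card \<B>"
    using beta by (intro card_image) (auto simp: inj_on_def)
  ultimately have card_P: "card (insert {} ?P) = 2 ^ k"
    using card_B finite by simp
  \<comment> \<open>The sums over \<open>F\<close> now attain \<open>|F|\<close>, so the characters cannot change sign on \<open>F\<close>.\<close>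
  have "insert {} ?P \<subseteq> ?H"
  proof -
    have "box_prop n B \<in> ?H" if "B \<in> \<B>" for B
    proof -
      have "\<bar>\<Sum>x\<in>?F. character (box_prop n B) x\<bar> = int (card ?F)"
        by (simp only: sum_F[OF that] card_F' of_nat_power of_nat_numeral)
      then have "character (box_prop n B) x = character (box_prop n B) y" if "x \<in> ?F" "y \<in> ?F" for x y
        by (rule constant_if_abs_sum_eq_card[OF finF abs_character _ that])
      then show ?thesis
        unfolding constant_characters_def using box_prop_subset by blast
    qed
    moreover have "{} \<in> ?H"
      by (simp add: constant_characters_def)
    ultimately show ?thesis by blast
  qed
  moreover have "finite ?H" by (rule finite_constant_characters)
  moreover have "card ?H \<le> card (insert {} ?P)"
  proof -
    have "2 ^ (n - k) * card ?H \<le> 2 ^ (n - k) * 2 ^ k"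
      using card_constant_characters[OF _ \<open>?F \<noteq> {}\<close>, of n] card_F' two_n by (simp add: mult.commute)
    then have "card ?H \<le> 2 ^ k" by simp
    then show ?thesis
      by (simp only: card_P)
  qed
  ultimately have H: "?H = insert {} ?P"
    by (metis card_seteq)
  have card_H: "card ?H = 2 ^ Suc (k - 1)"
    unfolding H card_P using \<open>3 \<le> k\<close> by simp
  have "2 ^ (k - 1) dvd k"
  proof (rule constant_weight_code_dvd)
    show "finite ?H" by fact
    show "finite T" if "T \<in> ?H" for T
      using that finite_subset[of T "{1..n}"] by (simp add: constant_characters_def)
    show "card T = k" if "T \<in> ?H" "T \<noteq> {}" for T
      using that alpha unfolding H by blast
  qed (use card_H sym_diff_constant_characters in auto)
  then have "2 ^ (k - 1) \<le> k"
    using \<open>3 \<le> k\<close> by (intro dvd_imp_le) auto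
  moreover have "k < 2 ^ (k - 1)"
    using \<open>3 \<le> k\<close>
  proof (induction k rule: dec_induct)
    case (step m)
    then show ?case by (cases m) auto
  qed simp
  ultimately show False by simp
qed

end
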